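(* Let $d = d(n) \ge 1$ be an integer-valued function with $d(n) = o(\log n)$ as $n \to \infty$. There are constants $A, a > 0$ and $D > 0$ such that for every sufficiently large $n$ there exists a set $X \subset \mathbb{R}^n$ with $|X| = n$ and doubling dimension at most $D$ such that the following holds. Let $G : \mathbb{R}^n \to \mathbb{R}^{d}$ be a random projection and let $F$ be the optimal facility location cost of $X$. Then with probability at least $2/3$ over $G$ there exists a solution $\mathcal{F}'$ for $GX$ whose cost for $GX$ is at most $(1 + A\, n^{-1/(2d)})$ times the optimal facility location cost of $GX$ (so it is a $(1+o(1))$-approximate solution for $GX$), but whose total cost when pulled back to $X$ is at least $a\, n^{1/(2d)} \cdot F = \omega(1) \cdot F$.
   Context: All norms are Euclidean. Facility location (uniform, opening cost 1): for a finite nonempty dataset $Y$ in a Euclidean space, a solution is a nonempty subset $\mathcal{F} \subseteq Y$, with cost $|\mathcal{F}| + \sum_{y \in Y} \min_{f \in \mathcal{F}} \|y - f\|$; the optimal cost is the minimum. $GX = \{Gx : x \in X\}$. A solution $\mathcal{F}' \subseteq GX$ is pulled back to $X$ via the correspondence $Gx \leftrightarrow x$ (almost surely a bijection), i.e. to $\{x \in X : Gx \in \mathcal{F}'\}$, and its cost is then evaluated for the dataset $X$. Doubling dimension: for $x \in X$, $r > 0$ let $B(x,r) = \{y \in X : \|x-y\| \le r\}$. The doubling constant $\lambda_X$ is the smallest $\lambda$ such that for all $x \in X$, $r > 0$ there is $S \subseteq X$ with $|S| \le \lambda$ and $B(x,r) \subseteq \bigcup_{s \in S} B(s, r/2)$.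 The doubling dimension is $d_X = \log_2 \lambda_X$. A random projection from $\mathbb{R}^m$ to $\mathbb{R}^d$ is a random linear map $G$ given by a $d \times m$ matrix with i.i.d. entries drawn from $\mathcal{N}(0, 1/d)$ (variance $1/d$). *)

theory Defs
  imports "HOL-Probability.Probability" "HOL-Library.Landau_Symbols"
begin

(* The dimension varies with n inside the statement, so R^m is the carrier
   topspace (Euclidean_space m): sequences of reals vanishing from index m on. *)

definition edist :: "nat \<Rightarrow> (nat \<Rightarrow> real) \<Rightarrow> (nat \<Rightarrow> real) \<Rightarrow> real" where
  "edist m x y = L2_set (\<lambda>i. x i - y i) {..<m}"

definition fl_solution :: "(nat \<Rightarrow> real) set \<Rightarrow> (nat \<Rightarrow> real) set \<Rightarrow> bool" where
  "fl_solution Y F \<longleftrightarrow> F \<subseteq> Y \<and> F \<noteq> {}"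

definition fl_cost :: "nat \<Rightarrow> (nat \<Rightarrow> real) set \<Rightarrow> (nat \<Rightarrow> real) set \<Rightarrow> real" where
  "fl_cost m Y F = real (card F) + (\<Sum>y\<in>Y. Min ((\<lambda>f. edist m y f) ` F))"

(* Meaningful for finite nonempty Y only, as is fl_cost for finite Y and solutions F. *)
definition fl_opt :: "nat \<Rightarrow> (nat \<Rightarrow> real) set \<Rightarrow> real" where
  "fl_opt m Y = Min (fl_cost m Y ` {F. fl_solution Y F})"

definition rel_ball :: "nat \<Rightarrow> (nat \<Rightarrow> real) set \<Rightarrow> (nat \<Rightarrow> real) \<Rightarrow> real \<Rightarrow> (nat \<Rightarrow> real) set" where
  "rel_ball m X x r = {y \<in> X. edist m x y \<le> r}"

(* For finite X the set of admissible constants contains card X, so LEAST is meaningful. *)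
definition doubling_constant :: "nat \<Rightarrow> (nat \<Rightarrow> real) set \<Rightarrow> nat" where
  "doubling_constant m X = (LEAST l. \<forall>x\<in>X. \<forall>r>0. \<exists>S\<subseteq>X.
     finite S \<and> card S \<le> l \<and> rel_ball m X x r \<subseteq> (\<Union>s\<in>S. rel_ball m X s (r / 2)))"

definition doubling_dim :: "nat \<Rightarrow> (nat \<Rightarrow> real) set \<Rightarrow> real" where
  "doubling_dim m X = log 2 (real (doubling_constant m X))"

(* The law of a d x m matrix with i.i.d. N(0, 1/d) entries; normal_density takes the
   standard deviation, not the variance. *)
definition random_projection :: "nat \<Rightarrow> nat \<Rightarrow> (nat \<times> nat \<Rightarrow> real) measure" where
  "random_projection m d = PiM ({..<d} \<times> {..<m})
     (\<lambda>_. density lborel (\<lambda>t. ennreal (normal_density 0 (sqrt (1 / real d)) t)))"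

(* The product of the d x m matrix G with x in R^m, zero-padded to be a point of R^d. *)
definition lin_map :: "nat \<Rightarrow> nat \<Rightarrow> (nat \<times> nat \<Rightarrow> real) \<Rightarrow> (nat \<Rightarrow> real) \<Rightarrow> (nat \<Rightarrow> real)" where
  "lin_map m d G x = (\<lambda>i. if i < d then \<Sum>j<m. G (i, j) * x j else 0)"

definition pull_back ::
  "((nat \<Rightarrow> real) \<Rightarrow> (nat \<Rightarrow> real)) \<Rightarrow> (nat \<Rightarrow> real) set \<Rightarrow> (nat \<Rightarrow> real) set \<Rightarrow> (nat \<Rightarrow> real) set" where
  "pull_back g X F' = {x \<in> X. g x \<in> F'}"

end

theory Submission
  imports Defs
begin

text \<open>
  Let \<open>e = n\<^sup>-\<^sup>1\<^sup>/\<^sup>(\<^sup>2\<^sup>d\<^sup>)\<close> and \<open>L = n / e\<close>. The dataset consists of the partial sums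
  \<open>x\<^sub>k = L (u\<^sub>0 + \<dots> + u\<^sub>k\<^sub>-\<^sub>1)\<close>, \<open>k < n\<close>, of the scaled standard basis.
  Their mutual distances are at least \<open>L\<close>, while opening every point costs \<open>n\<close>.
  The \<open>n - 1\<close> steps are projected to independent Gaussian vectors of typical length \<open>L\<close>, so the shortest one has length of order \<open>L n\<^sup>-\<^sup>1\<^sup>/\<^sup>d = n e\<close>. Opening all of \<open>GX\<close> except one endpoint of
  this step costs at most \<open>n (1 + O(e))\<close>, but in \<open>X\<close> the missing facility costs at least \<open>L\<close>.
  This solution is nearly optimal for \<open>GX\<close> because only a few points of \<open>GX\<close> have another one within
  distance 1: the first coordinate of \<open>G x\<^sub>k - G x\<^sub>l\<close> has standard deviation \<open>L (\<bar>k - l\<bar> / d)\<^sup>1\<^sup>/\<^sup>2\<close>,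
  hence the expected number of pairs within distance 1 is \<open>O((n d)\<^sup>1\<^sup>/\<^sup>2 e)\<close>, which is \<open>o(n e)\<close>.
\<close>

subsection \<open>Facility location costs\<close>

lemma edist_nonneg [simp]: "0 \<le> edist m x y"
  by (simp add: edist_def)

lemma edist_self [simp]: "edist m x x = 0"
  by (simp add: edist_def L2_set_def)

lemma edist_commute: "edist m x y = edist m y x"
  by (simp add: edist_def L2_set_def power2_commute)

lemma abs_le_edist: "i < m \<Longrightarrow> \<bar>x i - y i\<bar> \<le> edist m x y"
  using member_le_L2_set[of "{..<m}" i "\<lambda>i. \<bar>x i - y i\<bar>"]
  by (simp add: edist_def L2_set_def)

lemma finite_fl_solutions: "finite Y \<Longrightarrow> finite {F. fl_solution Y F}"
  by (rule finite_subset[of _ "Pow Y"]) (auto simp: fl_solution_def)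

lemma fl_opt_le: "finite Y \<Longrightarrow> fl_solution Y F \<Longrightarrow> fl_opt m Y \<le> fl_cost m Y F"
  unfolding fl_opt_def by (rule Min_le) (auto simp: finite_fl_solutions)

lemma fl_opt_ge:
  assumes "finite Y" "Y \<noteq> {}" "\<And>F. fl_solution Y F \<Longrightarrow> c \<le> fl_cost m Y F"
  shows "c \<le> fl_opt m Y"
proof -
  have "fl_solution Y Y" using assms by (simp add: fl_solution_def)
  then show ?thesis unfolding fl_opt_def
    using assms(3) by (subst Min_ge_iff) (auto simp: finite_fl_solutions assms)
qed

lemma Min_edist_mem:
  assumes "finite F" "y \<in> F"
  shows "Min ((\<lambda>f. edist m y f) ` F) = 0"
proof (rule antisym)
  show "Min ((\<lambda>f. edist m y f) ` F) \<le> 0"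
    using assms by (intro Min_le) (auto intro: rev_image_eqI)
  show "0 \<le> Min ((\<lambda>f. edist m y f) ` F)"
    using assms by (subst Min_ge_iff) auto
qed

lemma fl_cost_all: "finite Y \<Longrightarrow> fl_cost m Y Y = real (card Y)"
  unfolding fl_cost_def by (simp add: Min_edist_mem)

text \<open>The remaining points are open and connect at cost 0, so only the omitted point pays for
  a connection. The bounds on the bad solution, both in \<open>GX\<close> and in \<open>X\<close>,
  rest on this formula.\<close>

lemma fl_cost_remove:
  assumes "finite Y" "x \<in> Y" "Y - {x} \<noteq> {}"
  shows "fl_cost m Y (Y - {x}) = real (card Y) - 1 + Min ((\<lambda>f. edist m x f) ` (Y - {x}))"
proof -
  have "(\<Sum>y\<in>Y - {x}. Min ((\<lambda>f. edist m y f) ` (Y - {x}))) = 0"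
    using assms by (intro sum.neutral) (auto simp: Min_edist_mem)
  moreover have "1 \<le> card Y"
    using assms card_gt_0_iff[of Y] by auto
  ultimately show ?thesis
    using assms unfolding fl_cost_def by (simp add: sum.remove[of Y x] of_nat_diff)
qed

lemma fl_cost_remove_le:
  assumes "finite Y" "x \<in> Y" "y \<in> Y" "x \<noteq> y"
  shows "fl_cost m Y (Y - {x}) \<le> real (card Y) + edist m x y"
proof -
  have "Min ((\<lambda>f. edist m x f) ` (Y - {x})) \<le> edist m x y"
    using assms by (intro Min_le) auto
  moreover have "Y - {x} \<noteq> {}" using assms by auto
  ultimately show ?thesis using fl_cost_remove[of Y x m] assms by linarith
qed

lemma fl_cost_remove_ge:
  assumes "finite Y" "x \<in> Y" "Y - {x} \<noteq> {}" "\<And>y. y \<in> Y \<Longrightarrow> y \<noteq> x \<Longrightarrow> c \<le> edist m x y"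
  shows "c \<le> fl_cost m Y (Y - {x})"
proof -
  have "c \<le> Min ((\<lambda>f. edist m x f) ` (Y - {x}))"
    using assms by (subst Min_ge_iff) auto
  moreover have "1 \<le> real (card Y)"
    using assms card_gt_0_iff[of Y] by (auto simp: Suc_le_eq)
  ultimately show ?thesis using fl_cost_remove[OF assms(1-3), of m] by linarith
qed

text \<open>A point at distance at least 1 from all the others costs at least 1, whether it is opened or not.\<close>

lemma fl_opt_ge_isolated:
  assumes Y: "finite Y" "Y \<noteq> {}" and Z: "Z \<subseteq> Y"
    and iso: "\<And>z y. z \<in> Z \<Longrightarrow> y \<in> Y \<Longrightarrow> y \<noteq> z \<Longrightarrow> 1 \<le> edist m z y"
  shows "real (card Z) \<le> fl_opt m Y"
proof (rule fl_opt_ge[OF Y])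
  fix F assume "fl_solution Y F"
  then have F: "F \<subseteq> Y" "F \<noteq> {}" "finite F" using Y finite_subset by (auto simp: fl_solution_def)
  have finZ: "finite Z" using Z Y finite_subset by auto
  have ge0: "0 \<le> Min ((\<lambda>f. edist m y f) ` F)" for y
    using F by (subst Min_ge_iff) auto
  have "real (card (Z - F)) = (\<Sum>y\<in>Z - F. 1)" by simp
  also have "\<dots> \<le> (\<Sum>y\<in>Z - F. Min ((\<lambda>f. edist m y f) ` F))"
    using F iso by (intro sum_mono) (auto simp: Min_ge_iff)
  also have "\<dots> \<le> (\<Sum>y\<in>Y. Min ((\<lambda>f. edist m y f) ` F))"
    using Z Y ge0 by (intro sum_mono2) auto
  finally have "real (card (Z - F)) \<le> (\<Sum>y\<in>Y. Min ((\<lambda>f. edist m y f) ` F))" .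
  moreover have "card Z \<le> card F + card (Z - F)"
    using finZ F by (metis Un_Diff_cancel card_Un_le card_mono finite_Un finite_Diff le_trans Un_upper2)
  ultimately show "real (card Z) \<le> fl_cost m Y F" unfolding fl_cost_def by linarith
qed

subsection \<open>A walk along the coordinate directions\<close>

definition walk :: "real \<Rightarrow> nat \<Rightarrow> nat \<Rightarrow> real" where
  "walk L k = (\<lambda>i. if i < k then L else 0)"

lemma walk_in_Euclidean_space: "k \<le> n \<Longrightarrow> walk L k \<in> topspace (Euclidean_space n)"
  by (auto simp: topspace_Euclidean_space walk_def)

text \<open>The points differ in exactly |k - l| coordinates, each time by \<open>L\<close>.\<close>

lemma edist_walk:
  assumes "0 \<le> L" "k \<le> n" "l \<le> n"
  shows "edist n (walk L k) (walk L l) = L * sqrt \<bar>real k - real l\<bar>"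
proof -
  have *: "edist n (walk L k) (walk L l) = L * sqrt (real k - real l)" if "l \<le> k" "k \<le> n" for k l
  proof -
    have "(\<Sum>i<n. (walk L k i - walk L l i)\<^sup>2) = (\<Sum>i\<in>{l..<k}. L\<^sup>2)"
      using that by (intro sum.mono_neutral_cong_right) (auto simp: walk_def)
    then show ?thesis
      using that assms by (simp add: edist_def L2_set_def real_sqrt_mult of_nat_diff)
  qed
  show ?thesis
    using *[of l k] *[of k l] assms by (cases "l \<le> k") (auto simp: edist_commute[of n "walk L l"])
qed

lemma inj_walk: "L \<noteq> 0 \<Longrightarrow> inj (walk L)"
proof (rule injI)
  fix k l assume "L \<noteq> 0" "walk L k = walk L l"
  then have "\<And>i. i < k \<longleftrightarrow> i < l" unfolding walk_def by metis
  then show "k = l" by (metis linorder_neqE_nat less_irrefl)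
qed

text \<open>The centres are one representative of each nonempty fibre of \<open>f\<close>. Covering
  a ball thus reduces to labelling its points with few values such that equal labels force distance
  at most \<open>r\<close>.\<close>

lemma cover_by_fibres:
  assumes "B \<subseteq> X" "f ` B \<subseteq> T" "finite T"
    and "\<And>y z. y \<in> B \<Longrightarrow> z \<in> B \<Longrightarrow> f y = f z \<Longrightarrow> edist m y z \<le> r"
  shows "\<exists>S\<subseteq>X. finite S \<and> card S \<le> card T \<and> B \<subseteq> (\<Union>s\<in>S. rel_ball m X s r)"
proof (intro exI conjI)
  let ?S = "inv_into B f ` f ` B"
  have fin: "finite (f ` B)" using assms finite_subset by blast
  show "?S \<subseteq> X" using assms(1) inv_into_into[of _ f B] by blast
  show "finite ?S" using fin by simp
  show "card ?S \<le> card T" using card_image_le[OF fin] card_mono[OF assms(3,2)] le_trans by blast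
  show "B \<subseteq> (\<Union>s\<in>?S. rel_ball m X s r)"
  proof
    fix y assume y: "y \<in> B"
    then have "edist m (inv_into B f (f y)) y \<le> r"
      by (intro assms(4)) (auto intro: inv_into_into simp: f_inv_into_f)
    with y assms(1) show "y \<in> (\<Union>s\<in>?S. rel_ball m X s r)"
      by (auto simp: rel_ball_def)
  qed
qed

text \<open>The walk is the snowflake \<open>L \<bar>k - l\<bar>\<^sup>1\<^sup>/\<^sup>2\<close> of an interval of integers, so halving
  a radius amounts to dividing the length of an interval by 4.\<close>

lemma doubling_dim_walk:
  assumes L: "0 < L"
  shows "doubling_dim n (walk L ` {..<n}) \<le> 4"
proof -
  let ?X = "walk L ` {..<n}"
  have "\<exists>S\<subseteq>?X. finite S \<and> card S \<le> card {-4..4::int} \<and>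
      rel_ball n ?X x r \<subseteq> (\<Union>s\<in>S. rel_ball n ?X s (r / 2))" if x: "x \<in> ?X" and r: "0 < r" for x r
  proof -
    obtain k where k: "k < n" "x = walk L k" using x by auto
    \<comment> \<open>The radius measured in walk steps: distance at most \<open>r\<close> means
      index difference at most \<open>\<rho>\<close>.\<close>
    define \<rho> where "\<rho> = (r / L)\<^sup>2"
    have \<rho>: "0 < \<rho>" and sqrt_\<rho>: "sqrt \<rho> = r / L" using r L by (auto simp: \<rho>_def)
    define ind where "ind = inv (walk L)"
    have ind [simp]: "ind (walk L l) = l" for l
      using inj_walk[of L] L by (simp add: ind_def)
    \<comment> \<open>The label cuts the indices, counted from the centre \<open>k\<close>, into
      intervals of length \<open>\<rho> / 4\<close>. On the ball it takes only the 9 values -4..4,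
      and equal labels put points within \<open>L * sqrt (\<rho> / 4) = r / 2\<close>.\<close>
    define f where "f y = \<lfloor>4 * (real (ind y) - real k) / \<rho>\<rfloor>" for y
    show ?thesis
    proof (rule cover_by_fibres)
      show "f ` rel_ball n ?X x r \<subseteq> {-4..4}"
      proof safe
        fix y assume "y \<in> rel_ball n ?X x r"
        then obtain l where l: "l < n" "y = walk L l" and le: "L * sqrt \<bar>real k - real l\<bar> \<le> r"
          using edist_walk[of L k n] k L by (auto simp: rel_ball_def)
        have "sqrt \<bar>real k - real l\<bar> \<le> sqrt \<rho>"
          using le L by (simp add: sqrt_\<rho> pos_le_divide_eq mult.commute)
        then have "\<bar>real k - real l\<bar> \<le> \<rho>" by simp
        then have "-4 \<le> 4 * (real l - real k) / \<rho>" "4 * (real l - real k) / \<rho> \<le> 4"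
          using \<rho> by (auto simp: divide_simps)
        then show "f y \<in> {-4..4}"
          unfolding f_def l by (auto simp: le_floor_iff floor_le_iff)
      qed
      fix y z assume "y \<in> rel_ball n ?X x r" "z \<in> rel_ball n ?X x r" and eq: "f y = f z"
      then obtain l l' where l: "l < n" "y = walk L l" "l' < n" "z = walk L l'"
        by (auto simp: rel_ball_def)
      have "\<bar>4 * (real l - real k) / \<rho> - 4 * (real l' - real k) / \<rho>\<bar> < 1"
        using eq unfolding f_def l ind by linarith
      then have "\<bar>4 * (real l - real l') / \<rho>\<bar> < 1"
        by (simp add: diff_divide_distrib[symmetric] algebra_simps)
      then have "\<bar>4 * (real l - real l')\<bar> < \<rho>"
        using \<rho> by (simp add: pos_divide_less_eq)
      then have "\<bar>real l - real l'\<bar> \<le> \<rho> / 4"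
        unfolding abs_mult by simp
      then have "sqrt \<bar>real l - real l'\<bar> \<le> sqrt (\<rho> / 4)" by simp
      also have "\<dots> = r / L / 2" by (simp add: real_sqrt_divide sqrt_\<rho>)
      finally show "edist n y z \<le> r / 2"
        using L l by (simp add: edist_walk field_simps)
    qed (auto simp: rel_ball_def)
  qed
  then have "doubling_constant n ?X \<le> 9"
    unfolding doubling_constant_def by (intro Least_le) simp
  \<comment> \<open>The bound 9 is relaxed to 16 for an integral logarithm. The constant 0 of an
    empty dataset is a separate case, since the logarithm takes a default value there.\<close>
  then have "doubling_dim n ?X \<le> log 2 16"
    unfolding doubling_dim_def by (cases "doubling_constant n ?X = 0") (auto simp: log_def divide_right_mono)
  also have "log 2 16 = log 2 (2 ^ 4)" by simp
  also have "\<dots> = 4" by (subst log_nat_power) auto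
  finally show ?thesis .
qed

subsection \<open>Measurability\<close>

text \<open>Expresses a sum over the projected dataset, whose size depends on the projection, by sums over
  a fixed index set.\<close>

lemma sum_image_fibre_weights:
  fixes h :: "'b \<Rightarrow> real"
  assumes "finite S"
  shows "(\<Sum>y\<in>g ` S. h y) = (\<Sum>x\<in>S. h (g x) / (\<Sum>z\<in>S. if g z = g x then 1 else 0))"
proof -
  have "(\<Sum>x\<in>{x \<in> S. g x = y}. h (g x) / (\<Sum>z\<in>S. if g z = g x then 1 else 0)) = h y"
    if "y \<in> g ` S" for y
  proof -
    have "{x \<in> S. g x = y} \<noteq> {}" using that by auto
    then have "card {x \<in> S. g x = y} \<noteq> 0" using assms by simp
    moreover have "(\<Sum>x\<in>{x \<in> S. g x = y}. h (g x) / (\<Sum>z\<in>S. if g z = g x then 1 else 0))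
        = (\<Sum>x\<in>{x \<in> S. g x = y}. h y / real (card {x \<in> S. g x = y}))"
      using assms by (intro sum.cong) (auto simp: sum.If_cases Int_def)
    ultimately show ?thesis by simp
  qed
  then show ?thesis
    using assms by (subst (2) sum.image_gen[of S _ g]) auto
qed

context
  fixes M :: "'a measure" and g :: "'a \<Rightarrow> (nat \<Rightarrow> real) \<Rightarrow> (nat \<Rightarrow> real)" and m :: nat
    and X :: "(nat \<Rightarrow> real) set"
  assumes finite_X: "finite X"
    and edist_meas: "\<And>x y. (\<lambda>\<omega>. edist m (g \<omega> x) (g \<omega> y)) \<in> borel_measurable M"
    and eq_meas: "\<And>x y. Measurable.pred M (\<lambda>\<omega>. g \<omega> x = g \<omega> y)"
begin

text \<open>Weighting each point by 1 / (size of its fibre) makes all sums run over the fixed sets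
  \<open>S\<close> and \<open>X\<close>, even where \<open>g \<omega>\<close> identifies
  points.\<close>

lemma borel_measurable_fl_cost_image:
  assumes "S \<subseteq> X"
  shows "(\<lambda>\<omega>. fl_cost m (g \<omega> ` X) (g \<omega> ` S)) \<in> borel_measurable M"
proof -
  note [measurable] = edist_meas eq_meas
  have [measurable]: "finite S" using assms finite_X finite_subset by auto
  have "fl_cost m (g \<omega> ` X) (g \<omega> ` S) = (\<Sum>x\<in>S. 1 / (\<Sum>z\<in>S. if g \<omega> z = g \<omega> x then 1 else 0)) +
      (\<Sum>x\<in>X. Min ((\<lambda>s. edist m (g \<omega> x) (g \<omega> s)) ` S) / (\<Sum>z\<in>X. if g \<omega> z = g \<omega> x then 1 else 0))" for \<omega>
    using sum_image_fibre_weights[OF \<open>finite S\<close>, of "\<lambda>_. 1" "g \<omega>"]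
    unfolding fl_cost_def by (simp add: sum_image_fibre_weights[OF finite_X] image_image)
  then show ?thesis by simp
qed

text \<open>Solutions for the image are exactly the images of nonempty subsets of \<open>X\<close>,
  so the minimum runs over a fixed finite family.\<close>

lemma borel_measurable_fl_opt_image:
  assumes "X \<noteq> {}"
  shows "(\<lambda>\<omega>. fl_opt m (g \<omega> ` X)) \<in> borel_measurable M"
proof -
  have "{F. fl_solution (g \<omega> ` X) F} = (\<lambda>S. g \<omega> ` S) ` (Pow X - {{}})" for \<omega>
    by (auto simp: fl_solution_def subset_image_iff)
  then have "fl_opt m (g \<omega> ` X) = Min ((\<lambda>S. fl_cost m (g \<omega> ` X) (g \<omega> ` S)) ` (Pow X - {{}}))" for \<omega>
    by (simp add: fl_opt_def image_image)
  then show ?thesis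
    using finite_X
    by (simp, intro borel_measurable_Min borel_measurable_fl_cost_image) auto
qed

lemma pred_ex_fl_solution:
  "Measurable.pred M (\<lambda>\<omega>. \<exists>F'. fl_solution (g \<omega> ` X) F' \<and>
      fl_cost m (g \<omega> ` X) F' \<le> c * fl_opt m (g \<omega> ` X) \<and> b \<le> fl_cost k X (pull_back (g \<omega>) X F'))"
proof (cases "X = {}")
  case True
  then show ?thesis by (simp add: fl_solution_def)
next
  case False
  note [measurable] = eq_meas borel_measurable_fl_opt_image[OF False]
  \<comment> \<open>\<open>Q\<close> says through finitely many coincidences of image points that
    \<open>T\<close> is the pull-back of the image of \<open>S\<close>. Ranging over all candidates
    \<open>T\<close> leaves only costs of fixed sets in \<open>X\<close>.\<close>
  define Q where "Q \<omega> S T \<longleftrightarrow> (\<forall>x\<in>X. x \<in> T \<longleftrightarrow> (\<exists>s\<in>S. g \<omega> x = g \<omega> s))" for \<omega> S T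
  have pb: "pull_back (g \<omega>) X (g \<omega> ` S) = T \<longleftrightarrow> Q \<omega> S T" if "T \<subseteq> X" for \<omega> S T
    using that by (auto simp: pull_back_def Q_def)
  have sub: "pull_back (g \<omega>) X F \<subseteq> X" for \<omega> F by (auto simp: pull_back_def)
  have "(\<exists>F'. fl_solution (g \<omega> ` X) F' \<and>
      fl_cost m (g \<omega> ` X) F' \<le> c * fl_opt m (g \<omega> ` X) \<and> b \<le> fl_cost k X (pull_back (g \<omega>) X F')) \<longleftrightarrow>
    (\<exists>S\<in>Pow X - {{}}. fl_cost m (g \<omega> ` X) (g \<omega> ` S) \<le> c * fl_opt m (g \<omega> ` X) \<and>
       (\<exists>T\<in>Pow X. Q \<omega> S T \<and> b \<le> fl_cost k X T))" (is "_ = ?R \<omega>") for \<omega>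
  proof -
    have "(\<exists>T\<in>Pow X. Q \<omega> S T \<and> b \<le> fl_cost k X T) \<longleftrightarrow> b \<le> fl_cost k X (pull_back (g \<omega>) X (g \<omega> ` S))" for S
      using pb[of _ \<omega> S] sub[of \<omega> "g \<omega> ` S"] by auto
    then show ?thesis
      by (auto simp: fl_solution_def subset_image_iff)
  qed
  moreover have "Measurable.pred M (\<lambda>\<omega>. ?R \<omega>)"
  proof (intro pred_intros_finite pred_intros_logic)
    fix S T assume S: "S \<in> Pow X - {{}}"
    have [measurable]: "(\<lambda>\<omega>. fl_cost m (g \<omega> ` X) (g \<omega> ` S)) \<in> borel_measurable M"
      using S by (intro borel_measurable_fl_cost_image) auto
    have fin: "finite S" "finite X" using S finite_X finite_subset by auto
    show "Measurable.pred M (\<lambda>\<omega>. fl_cost m (g \<omega> ` X) (g \<omega> ` S) \<le> c * fl_opt m (g \<omega> ` X))"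
      by measurable
    show "Measurable.pred M (\<lambda>\<omega>. Q \<omega> S T)"
      unfolding Q_def by (intro pred_intros_finite pred_intros_logic fin eq_meas) auto
  qed (use finite_X in auto)
  ultimately show ?thesis by simp
qed

end

subsection \<open>Gaussian estimates\<close>

text \<open>The density is at most \<open>1 / (s * sqrt (2 * pi)) \<le> 1 / (2 * s)\<close>, and the
  interval has length \<open>2 * r\<close>.\<close>

lemma (in prob_space) normal_prob_abs_le:
  assumes X: "distributed M lborel X (normal_density 0 s)" and "0 < s" "0 \<le> r"
  shows "prob {\<omega> \<in> space M. \<bar>X \<omega>\<bar> \<le> r} \<le> r / s"
proof -
  have "emeasure M (X -` {-r..r} \<inter> space M) = (\<integral>\<^sup>+x. ennreal (normal_density 0 s x) * indicator {-r..r} x \<partial>lborel)"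
    by (rule distributed_emeasure[OF X]) auto
  also have "\<dots> \<le> (\<integral>\<^sup>+x. ennreal (1 / (2 * s)) * indicator {-r..r} x \<partial>lborel)"
  proof (intro nn_integral_mono mult_right_mono ennreal_leI)
    fix x
    have "(2::real)\<^sup>2 \<le> 2 * pi" using pi_gt3 by simp
    then have "2 \<le> sqrt (2 * pi)" using real_le_rsqrt by blast
    then have "2 * s \<le> sqrt (2 * pi * s\<^sup>2)" using \<open>0 < s\<close> by (simp add: real_sqrt_mult)
    then have "1 / sqrt (2 * pi * s\<^sup>2) * exp (- (x - 0)\<^sup>2 / (2 * s\<^sup>2)) \<le> 1 / (2 * s) * 1"
      using \<open>0 < s\<close> by (intro mult_mono frac_le) auto
    then show "normal_density 0 s x \<le> 1 / (2 * s)" by (simp add: normal_density_def)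
  qed simp
  also have "\<dots> = ennreal (r / s)"
    using assms by (subst nn_integral_cmult_indicator) (auto simp: ennreal_mult'[symmetric] field_simps)
  finally show ?thesis
    using assms by (simp add: emeasure_eq_measure vimage_def Int_def conj_commute abs_le_iff minus_le_iff)
qed

text \<open>Within one standard deviation the density is at least
  \<open>exp (- 1 / 2) / (4 * s) \<ge> 1 / (8 * s)\<close>; \<open>t \<le> 1\<close> keeps the
  interval of length \<open>2 * t * s\<close> in that range.\<close>

lemma (in prob_space) normal_prob_abs_ge:
  assumes X: "distributed M lborel X (normal_density 0 s)" and "0 < s" "0 \<le> t" "t \<le> 1"
  shows "t / 4 \<le> prob {\<omega> \<in> space M. \<bar>X \<omega>\<bar> \<le> t * s}"
proof -
  have "ennreal (t / 4) = (\<integral>\<^sup>+x. ennreal (1 / (8 * s)) * indicator {- (t * s)..t * s} x \<partial>lborel)"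
    using assms by (subst nn_integral_cmult_indicator) (auto simp: ennreal_mult'[symmetric] field_simps)
  also have "\<dots> \<le> (\<integral>\<^sup>+x. ennreal (normal_density 0 s x) * indicator {- (t * s)..t * s} x \<partial>lborel)"
  proof (intro nn_integral_mono)
    fix x
    have "1 / (8 * s) \<le> normal_density 0 s x" if "x \<in> {- (t * s)..t * s}"
    proof -
      have "2 * pi \<le> 4\<^sup>2" using pi_less_4 by simp
      then have "sqrt (2 * pi) \<le> 4" using real_le_lsqrt by simp
      then have 1: "sqrt (2 * pi * s\<^sup>2) \<le> 4 * s" using \<open>0 < s\<close> by (simp add: real_sqrt_mult)
      have "t * s \<le> s" using assms by simp
      with that have "\<bar>x\<bar> \<le> s" by auto
      then have "x\<^sup>2 \<le> s\<^sup>2" using \<open>0 < s\<close> by (simp add: power2_le_iff_abs_le)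
      then have "x\<^sup>2 / (2 * s\<^sup>2) \<le> 1 / 2" using \<open>0 < s\<close> by (simp add: divide_simps)
      moreover have "1 / 2 \<le> exp (- 1 / 2 :: real)" using exp_ge_add_one_self[of "- 1 / 2"] by simp
      ultimately have 2: "1 / 2 \<le> exp (- x\<^sup>2 / (2 * s\<^sup>2))"
        by (smt (verit) exp_le_cancel_iff minus_divide_left)
      have "1 / (4 * s) * (1 / 2) \<le> 1 / sqrt (2 * pi * s\<^sup>2) * exp (- (x - 0)\<^sup>2 / (2 * s\<^sup>2))"
        using 1 2 \<open>0 < s\<close> by (intro mult_mono frac_le) auto
      then show ?thesis by (simp add: normal_density_def)
    qed
    then show "ennreal (1 / (8 * s)) * indicator {- (t * s)..t * s} x \<le> ennreal (normal_density 0 s x) * indicator {- (t * s)..t * s} x"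
      by (auto simp: indicator_def intro!: ennreal_leI)
  qed
  also have "\<dots> = emeasure M (X -` {- (t * s)..t * s} \<inter> space M)"
    by (rule distributed_emeasure[OF X, symmetric]) auto
  finally show ?thesis
    using assms by (simp add: emeasure_eq_measure vimage_def Int_def conj_commute abs_le_iff minus_le_iff)
qed

text \<open>The coordinates together form the identity map, so their joint law is the product
  measure itself, whose factors are the marginal laws.\<close>

lemma indep_vars_PiM_coordinates:
  assumes "\<And>i. prob_space (M i)" "I \<noteq> {}"
  shows "prob_space.indep_vars (PiM I M) M (\<lambda>i x. x i) I"
proof -
  interpret product_prob_space M I by (rule product_prob_spaceI) fact
  have "distr (PiM I M) (PiM I M) (\<lambda>x. \<lambda>i\<in>I. x i) = distr (PiM I M) (PiM I M) (\<lambda>x. x)"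
    by (intro distr_cong) (auto simp: space_PiM PiE_restrict)
  also have "\<dots> = PiM I (\<lambda>i. distr (PiM I M) (M i) (\<lambda>x. x i))"
    by (subst distr_id) (intro PiM_cong refl PiM_component[symmetric])
  finally show ?thesis
    using assms(2) by (subst P.indep_vars_iff_distr_eq_PiM') auto
qed

text \<open>Comparing first coordinates only yields a superset of the pairs at distance at most 1
  and leaves a one-dimensional Gaussian question. The condition \<open>l < k\<close> lists each pair
  once.\<close>

definition close_pairs :: "nat \<Rightarrow> nat \<Rightarrow> real \<Rightarrow> (nat \<times> nat \<Rightarrow> real) \<Rightarrow> (nat \<times> nat) set" where
  "close_pairs m d L G = {(k, l). l < k \<and> k < m \<and>
     \<bar>lin_map m d G (walk L k) 0 - lin_map m d G (walk L l) 0\<bar> \<le> 1}"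

text \<open>Telescoping: multiplying by the conjugate bounds each term by twice the difference of
  consecutive square roots.\<close>

lemma sum_inverse_sqrt_le: "(\<Sum>i<n. 1 / sqrt (real (Suc i))) \<le> 2 * sqrt (real n)"
proof (induction n)
  case (Suc n)
  have "1 = (sqrt (real (Suc n)) - sqrt (real n)) * (sqrt (real (Suc n)) + sqrt (real n))"
    by (simp add: algebra_simps)
  also have "\<dots> \<le> (sqrt (real (Suc n)) - sqrt (real n)) * (2 * sqrt (real (Suc n)))"
    by (intro mult_left_mono) auto
  finally have "1 / sqrt (real (Suc n)) \<le> 2 * (sqrt (real (Suc n)) - sqrt (real n))"
    by (simp add: pos_divide_le_eq del: of_nat_Suc) (simp add: algebra_simps del: of_nat_Suc)
  with Suc show ?case by (simp del: of_nat_Suc)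
qed simp

section \<open>The walk under a random projection\<close>

lemma prob_space_random_projection:
  assumes "1 \<le> d"
  shows "prob_space (random_projection m d)"
  unfolding random_projection_def
  by (intro prob_space_PiM prob_space_normal_density) (use assms in simp)

context
  fixes m d :: nat
  assumes m: "1 \<le> m" and d: "1 \<le> d"
begin

private abbreviation (input) "M \<equiv> random_projection m d"
private abbreviation (input) "\<sigma> \<equiv> sqrt (1 / real d)"
private abbreviation (input) "I \<equiv> {..<d} \<times> {..<m}"

interpretation prob_space M
  using d by (rule prob_space_random_projection)

lemma sets_random_projection: "sets M = sets (PiM I (\<lambda>_. borel))"
  unfolding random_projection_def by (intro sets_PiM_cong) auto

lemma measurable_entry: "p \<in> I \<Longrightarrow> (\<lambda>G. G p) \<in> borel_measurable M"
  unfolding measurable_cong_sets[OF sets_random_projection refl] by simp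

lemma measurable_lin_map: "(\<lambda>G. lin_map m d G x i) \<in> borel_measurable M"
  unfolding lin_map_def
  by (cases "i < d") (auto intro!: borel_measurable_sum borel_measurable_times measurable_entry)

lemma measurable_edist_lin_map: "(\<lambda>G. edist d (lin_map m d G x) (lin_map m d G y)) \<in> borel_measurable M"
proof -
  note [measurable] = measurable_lin_map
  show ?thesis unfolding edist_def L2_set_def by measurable
qed

lemma pred_lin_map_eq: "Measurable.pred M (\<lambda>G. lin_map m d G x = lin_map m d G y)"
proof -
  have "lin_map m d G x = lin_map m d G y \<longleftrightarrow> (\<forall>i\<in>{..<d}. lin_map m d G x i = lin_map m d G y i)" for G
    by (auto simp: lin_map_def fun_eq_iff)
  moreover have "Measurable.pred M (\<lambda>G. lin_map m d G x i = lin_map m d G y i)" for i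
    unfolding pred_def by (intro borel_measurable_eq measurable_lin_map)
  then have "Measurable.pred M (\<lambda>G. \<forall>i\<in>{..<d}. lin_map m d G x i = lin_map m d G y i)"
    by (intro pred_intros_finite finite_lessThan)
  ultimately show ?thesis by (simp only:)
qed

lemma indep_entries: "indep_vars (\<lambda>_. borel) (\<lambda>p G. G p) I"
proof -
  have "indep_vars (\<lambda>_. density lborel (\<lambda>t. ennreal (normal_density 0 \<sigma> t))) (\<lambda>p G. G p) I"
    unfolding random_projection_def
    using m d by (intro indep_vars_PiM_coordinates prob_space_normal_density) (auto simp: lessThan_empty_iff)
  from indep_vars_compose2[OF this, of "\<lambda>_ x. x" "\<lambda>_. borel"] show ?thesis by simp
qed

lemma distributed_entry:
  assumes "p \<in> I"
  shows "distributed M lborel (\<lambda>G. G p) (normal_density 0 \<sigma>)"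
proof -
  let ?N = "density lborel (\<lambda>t. ennreal (normal_density 0 \<sigma> t))"
  interpret product_prob_space "\<lambda>_. ?N" I
    by (rule product_prob_spaceI, rule prob_space_normal_density) (use d in simp)
  have "distr M lborel (\<lambda>G. G p) = distr M ?N (\<lambda>G. G p)"
    by (rule distr_cong) auto
  also have "\<dots> = ?N"
    using PiM_component[OF assms] by (simp add: random_projection_def)
  finally show ?thesis
    using measurable_entry[OF assms] by (simp add: distributed_def)
qed

lemma distributed_row_sum:
  assumes "i < d" "l < k" "k \<le> m"
  shows "distributed M lborel (\<lambda>G. \<Sum>j\<in>{l..<k}. G (i, j)) (normal_density 0 (sqrt ((real k - real l) / real d)))"
proof -
  let ?J = "{i} \<times> {l..<k}"
  have J: "?J \<subseteq> I" "?J \<noteq> {}" "finite ?J" using assms by auto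
  have "distributed M lborel (\<lambda>G. \<Sum>p\<in>?J. G p) (normal_density (\<Sum>p\<in>?J. 0) (sqrt (\<Sum>p\<in>?J. \<sigma>\<^sup>2)))"
    using J d by (intro sum_indep_normal indep_vars_subset[OF indep_entries] distributed_entry) auto
  moreover have "(\<Sum>p\<in>?J. G p) = (\<Sum>j\<in>{l..<k}. G (i, j))" for G :: "nat \<times> nat \<Rightarrow> real"
    by (subst sum.cartesian_product[symmetric, of "\<lambda>i j. G (i, j)", simplified]) auto
  ultimately show ?thesis
    using assms d by (simp add: of_nat_diff card_cartesian_product)
qed

text \<open>The \<open>d\<close> entries of a column are independent, and each is this small with
  probability at least \<open>t / 4\<close>.\<close>

lemma prob_small_column:
  assumes "0 \<le> t" "t \<le> 1" "j < m"
  shows "(t / 4) ^ d \<le> prob {G \<in> space M. \<forall>i<d. \<bar>G (i, j)\<bar> \<le> t * \<sigma>}"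
proof -
  let ?J = "{..<d} \<times> {j}"
  have J: "?J \<subseteq> I" "?J \<noteq> {}" "finite ?J" using assms d by (auto simp: lessThan_empty_iff)
  let ?A = "\<lambda>p. (\<lambda>G. G p) -` {-(t * \<sigma>)..t * \<sigma>} \<inter> space M"
  have A: "?A p = {G \<in> space M. \<bar>G p\<bar> \<le> t * \<sigma>}" for p
    by (auto simp: abs_le_iff)
  have "(t / 4) ^ d = (\<Prod>p\<in>?J. t / 4)"
    by (simp add: card_cartesian_product)
  also have "\<dots> \<le> (\<Prod>p\<in>?J. prob (?A p))"
    unfolding A using assms J d by (intro prod_mono conjI normal_prob_abs_ge distributed_entry) auto
  also have "\<dots> = prob (\<Inter>p\<in>?J. ?A p)"
    using J by (intro indep_varsD[OF indep_entries, symmetric]) auto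
  also have "(\<Inter>p\<in>?J. ?A p) = {G \<in> space M. \<forall>i<d. \<bar>G (i, j)\<bar> \<le> t * \<sigma>}"
    unfolding A using J(2) by blast
  finally show ?thesis .
qed

text \<open>Column \<open>j\<close> is, up to the factor \<open>L\<close>, the projection of step
  \<open>j\<close> of the walk. Distinct columns are disjoint blocks of independent entries, so with
  \<open>p = (t / 4) ^ d\<close> all of the first \<open>r\<close> fail with probability at most
  \<open>(1 - p) ^ r \<le> exp (- r * p)\<close>.\<close>

lemma prob_ex_small_column:
  assumes "0 \<le> t" "t \<le> 1" "r \<le> m"
  shows "1 - exp (- real r * (t / 4) ^ d) \<le> prob {G \<in> space M. \<exists>j<r. \<forall>i<d. \<bar>G (i, j)\<bar> \<le> t * \<sigma>}"
proof (cases "r = 0")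
  case False
  define s where "s = t * \<sigma>"
  let ?K = "\<lambda>j. {..<d} \<times> {j}"
  \<comment> \<open>Stated over the block \<open>?K j\<close>, so that it depends only on the
    restriction \<open>?X j G\<close>; these restrictions are the independent variables.\<close>
  define Q where "Q j G \<longleftrightarrow> (\<forall>p\<in>?K j. \<bar>G p\<bar> \<le> s)" for j :: nat and G
  have Q: "Q j G \<longleftrightarrow> (\<forall>i<d. \<bar>G (i, j)\<bar> \<le> s)" for j G
    unfolding Q_def by blast
  let ?A = "\<lambda>j. {x \<in> space (PiM (?K j) (\<lambda>_. borel)). \<not> Q j x}"
  let ?X = "\<lambda>j G. restrict (\<lambda>p. G p) (?K j)"
  have Q_meas: "{G \<in> space M. Q j G} \<in> events" if "j < r" for j
  proof -
    have "Measurable.pred M (\<lambda>G. \<bar>G p\<bar> \<le> s)" if "p \<in> ?K j" for p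
    proof -
      have [measurable]: "(\<lambda>G. G p) \<in> borel_measurable M"
        using assms that \<open>j < r\<close> by (intro measurable_entry) auto
      show ?thesis by measurable
    qed
    then have "Measurable.pred M (Q j)"
      unfolding Q_def by (intro pred_intros_finite) auto
    then show ?thesis by (simp only: pred_def)
  qed
  have A: "?A j \<in> sets (PiM (?K j) (\<lambda>_. borel))" for j
    unfolding Q_def by measurable
  have vim: "?X j -` ?A j \<inter> space M = space M - {G \<in> space M. Q j G}" for j
  proof -
    have "?X j G \<in> space (PiM (?K j) (\<lambda>_. borel))" for G :: "nat \<times> nat \<Rightarrow> real"
      by (simp add: space_PiM)
    moreover have "Q j (?X j G) \<longleftrightarrow> Q j G" for G
      unfolding Q_def by (intro ball_cong refl) (simp only: restrict_apply' if_True)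
    ultimately show ?thesis by blast
  qed
  have ind: "indep_vars (\<lambda>j. PiM (?K j) (\<lambda>_. borel)) ?X {..<r}"
    using assms by (intro indep_vars_restrict[OF indep_entries]) (auto simp: disjoint_family_on_def)
  have "prob (\<Inter>j\<in>{..<r}. ?X j -` ?A j \<inter> space M) = (\<Prod>j<r. prob (?X j -` ?A j \<inter> space M))"
    using False by (intro indep_varsD[OF ind] A) (auto simp: lessThan_empty_iff)
  also have "\<dots> = (\<Prod>j<r. 1 - prob {G \<in> space M. Q j G})"
    unfolding vim by (intro prod.cong refl prob_compl Q_meas) auto
  also have "\<dots> \<le> (\<Prod>j<r. 1 - (t / 4) ^ d)"
  proof (intro prod_mono conjI diff_left_mono)
    fix j assume "j \<in> {..<r}"
    then show "(t / 4) ^ d \<le> prob {G \<in> space M. Q j G}"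
      unfolding Q s_def using assms by (intro prob_small_column) auto
  qed simp
  also have "\<dots> = (1 - (t / 4) ^ d) ^ r" by simp
  also have "\<dots> \<le> exp (- ((t / 4) ^ d)) ^ r"
  proof (rule power_mono)
    show "1 - (t / 4) ^ d \<le> exp (- ((t / 4) ^ d))"
      using exp_ge_add_one_self[of "- ((t / 4) ^ d)"] by simp
    show "0 \<le> 1 - (t / 4) ^ d"
      using assms power_le_one[of "t / 4" d] by simp
  qed
  also have "\<dots> = exp (- real r * (t / 4) ^ d)"
    by (simp add: exp_of_nat_mult[symmetric])
  also have "(\<Inter>j\<in>{..<r}. ?X j -` ?A j \<inter> space M) = space M - {G \<in> space M. \<exists>j<r. Q j G}"
    unfolding vim using False by blast
  also have "prob \<dots> = 1 - prob {G \<in> space M. \<exists>j<r. Q j G}"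
  proof (rule prob_compl)
    have "{G \<in> space M. \<exists>j<r. Q j G} = (\<Union>j\<in>{..<r}. {G \<in> space M. Q j G})" by blast
    also have "\<dots> \<in> events" by (intro sets.finite_UN Q_meas) auto
    finally show "{G \<in> space M. \<exists>j<r. Q j G} \<in> events" .
  qed
  finally show ?thesis unfolding Q s_def by linarith
qed simp

lemma lin_map_walk_diff:
  assumes "i < d" "l \<le> k" "k \<le> m"
  shows "lin_map m d G (walk L k) i - lin_map m d G (walk L l) i = L * (\<Sum>j\<in>{l..<k}. G (i, j))"
proof -
  have "lin_map m d G (walk L k) i - lin_map m d G (walk L l) i = (\<Sum>j<m. G (i, j) * (walk L k j - walk L l j))"
    using assms by (simp add: lin_map_def sum_subtractf right_diff_distrib)
  also have "\<dots> = (\<Sum>j\<in>{l..<k}. L * G (i, j))"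
    using assms by (intro sum.mono_neutral_cong_right) (auto simp: walk_def)
  finally show ?thesis by (simp add: sum_distrib_left)
qed

text \<open>The first coordinate of the difference is \<open>L\<close> times a sum of
  \<open>k - l\<close> independent entries, hence Gaussian. The case \<open>r = 0\<close> excludes
  collisions, the case \<open>r = 1\<close> controls close pairs.\<close>

lemma prob_walk_close:
  assumes "0 < L" "0 \<le> r" "l < k" "k \<le> m"
  shows "prob {G \<in> space M. \<bar>lin_map m d G (walk L k) 0 - lin_map m d G (walk L l) 0\<bar> \<le> r}
    \<le> r * sqrt (real d) / (L * sqrt (real k - real l))"
proof -
  have "\<bar>lin_map m d G (walk L k) 0 - lin_map m d G (walk L l) 0\<bar> \<le> r \<longleftrightarrow>
      \<bar>\<Sum>j\<in>{l..<k}. G (0, j)\<bar> \<le> r / L" for G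
    using assms d by (simp add: lin_map_walk_diff abs_mult pos_le_divide_eq mult.commute)
  moreover have "prob {G \<in> space M. \<bar>\<Sum>j\<in>{l..<k}. G (0, j)\<bar> \<le> r / L}
     \<le> (r / L) / sqrt ((real k - real l) / real d)"
    using assms d by (intro normal_prob_abs_le distributed_row_sum) auto
  ultimately show ?thesis
    using assms d by (simp add: real_sqrt_divide)
qed

text \<open>Coinciding images agree in the first coordinate, an event of probability 0 for each of
  the finitely many pairs.\<close>

lemma AE_inj_on_lin_map_walk:
  assumes L: "0 < L"
  shows "AE G in M. inj_on (lin_map m d G) (walk L ` {..<m})"
proof -
  have *: "AE G in M. lin_map m d G (walk L k) \<noteq> lin_map m d G (walk L l)" if "l < k" "k < m" for k l
  proof -
    let ?E = "{G \<in> space M. \<bar>lin_map m d G (walk L k) 0 - lin_map m d G (walk L l) 0\<bar> \<le> 0}"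
    note [measurable] = measurable_lin_map
    have "prob ?E = 0"
      using prob_walk_close[of L 0 l k] that L by (simp add: measure_le_0_iff)
    then have "?E \<in> null_sets M"
      by (simp add: emeasure_eq_measure null_sets_def)
    from AE_not_in[OF this] AE_space show ?thesis by eventually_elim auto
  qed
  have "AE G in M. \<forall>k\<in>{..<m}. \<forall>l\<in>{..<k}. lin_map m d G (walk L k) \<noteq> lin_map m d G (walk L l)"
    by (intro AE_finite_allI *) auto
  then show ?thesis
  proof eventually_elim
    case (elim G)
    show ?case
    proof (rule inj_onI, safe)
      fix k l assume "k < m" "l < m" "lin_map m d G (walk L k) = lin_map m d G (walk L l)"
      with elim have "\<not> k < l" "\<not> l < k" by (metis lessThan_iff)+
      then show "walk L k = walk L l" by simp
    qed
  qed
qed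

text \<open>First moment method: a pair is close with probability at most
  \<open>sqrt d / (L * sqrt (k - l))\<close>, and for each \<open>k\<close> the sum of
  \<open>1 / sqrt (k - l)\<close> over \<open>l\<close> is at most
  \<open>2 * sqrt m\<close>.\<close>

lemma close_pairs_Markov:
  assumes L: "0 < L" and c: "0 < c"
  shows "1 - 2 * real m * sqrt (real m * real d) / (L * c)
      \<le> prob {G \<in> space M. real (card (close_pairs m d L G)) < c}"
proof -
  note [measurable] = measurable_lin_map
  define P where "P = Sigma {..<m} (\<lambda>k. {..<k})"
  have finP: "finite P" by (simp add: P_def)
  define E where "E p = {G \<in> space M. \<bar>lin_map m d G (walk L (fst p)) 0 - lin_map m d G (walk L (snd p)) 0\<bar> \<le> 1}"
    for p
  have [measurable]: "E p \<in> events" for p unfolding E_def by measurable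
  define h where "h G = (\<Sum>p\<in>P. indicator (E p) G :: real)" for G
  have h: "real (card (close_pairs m d L G)) = h G" if "G \<in> space M" for G
  proof -
    have "close_pairs m d L G = {p \<in> P. G \<in> E p}"
      using that by (auto simp: close_pairs_def P_def E_def)
    then show ?thesis using finP by (simp add: h_def indicator_def sum.If_cases Int_def)
  qed
  have [measurable]: "h \<in> borel_measurable M" unfolding h_def by measurable
  have eq: "{G \<in> space M. real (card (close_pairs m d L G)) < c} = {G \<in> space M. h G < c}"
    by (intro Collect_cong conj_cong refl) (simp only: h)
  have int_E: "integrable M (indicator (E p) :: _ \<Rightarrow> real)" for p
    by (rule integrable_real_indicator) (simp_all add: less_top[symmetric])
  have int: "integrable M h" unfolding h_def 
    by (intro Bochner_Integration.integrable_sum int_E)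
  have "expectation h = (\<Sum>p\<in>P. prob (E p))"
    unfolding h_def by (simp add: Bochner_Integration.integral_sum[OF int_E])
  also have "\<dots> \<le> (\<Sum>p\<in>P. sqrt (real d) / L * (1 / sqrt (real (fst p) - real (snd p))))"
  proof (intro sum_mono)
    fix p assume "p \<in> P"
    then show "prob (E p) \<le> sqrt (real d) / L * (1 / sqrt (real (fst p) - real (snd p)))"
      using prob_walk_close[of L 1 "snd p" "fst p"] L by (auto simp: P_def E_def)
  qed
  also have "\<dots> = sqrt (real d) / L * (\<Sum>k<m. \<Sum>l<k. 1 / sqrt (real k - real l))"
    unfolding P_def by (simp add: sum.Sigma sum_distrib_left case_prod_beta)
  also have "\<dots> \<le> sqrt (real d) / L * (\<Sum>k<m. 2 * sqrt (real m))"
  proof (intro mult_left_mono sum_mono)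
    fix k assume "k \<in> {..<m}"
    \<comment> \<open>The reflection \<open>l \<mapsto> k - 1 - l\<close> lets the differences
      \<open>k - l\<close> run through 1, ..., k in increasing order.\<close>
    have "(\<Sum>l<k. 1 / sqrt (real k - real l)) = (\<Sum>l<k. 1 / sqrt (real (Suc (k - Suc l))))"
      by (intro sum.cong) (auto simp: of_nat_diff)
    also have "\<dots> = (\<Sum>l<k. 1 / sqrt (real (Suc l)))"
      by (rule sum.nat_diff_reindex)
    also have "\<dots> \<le> 2 * sqrt (real k)" by (rule sum_inverse_sqrt_le)
    also have "\<dots> \<le> 2 * sqrt (real m)" using \<open>k \<in> {..<m}\<close> by simp
    finally show "(\<Sum>l<k. 1 / sqrt (real k - real l)) \<le> 2 * sqrt (real m)" .
  qed (use L in simp)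
  also have "\<dots> = 2 * real m * sqrt (real m * real d) / L"
    by (simp add: real_sqrt_mult)
  finally have exp_le: "expectation h \<le> 2 * real m * sqrt (real m * real d) / L" .
  have "prob {G \<in> space M. c \<le> h G} \<le> expectation h / c"
    using c by (intro integral_Markov_inequality_measure[OF int, where A = "{}"]) (auto simp: h_def intro!: sum_nonneg)
  also have "\<dots> \<le> 2 * real m * sqrt (real m * real d) / (L * c)"
    using divide_right_mono[OF exp_le, of c] c by simp
  finally have "1 - 2 * real m * sqrt (real m * real d) / (L * c) \<le> 1 - prob {G \<in> space M. c \<le> h G}"
    by simp
  also have "\<dots> = prob (space M - {G \<in> space M. c \<le> h G})"
    by (intro prob_compl[symmetric]) measurable
  also have "space M - {G \<in> space M. c \<le> h G} = {G \<in> space M. real (card (close_pairs m d L G)) < c}"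
    unfolding eq by (auto simp only: not_le)
  finally show "1 - 2 * real m * sqrt (real m * real d) / (L * c)
      \<le> prob {G \<in> space M. real (card (close_pairs m d L G)) < c}" .
qed

end

subsection \<open>The bad solution\<close>

text \<open>The deterministic half of the argument: all randomness enters through the conditions
  \<open>inj\<close>, \<open>short\<close> and \<open>few\<close> on a fixed matrix
  \<open>G\<close>.\<close>

lemma ex_bad_solution:
  fixes e :: real
  assumes n: "2 \<le> n" and d: "1 \<le> d" and e: "0 < e" "e \<le> 1 / 2"
    and X: "X = walk (real n / e) ` {..<n}"
    and inj: "inj_on (lin_map n d G) X"
    and short: "j < n - 1" "\<forall>i<d. \<bar>G (i, j)\<bar> \<le> 32 * e\<^sup>2 * sqrt (1 / real d)"
    and few: "real (card (close_pairs n d (real n / e) G)) < real n * e / 2"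
  shows "\<exists>F'. fl_solution (lin_map n d G ` X) F' \<and>
    fl_cost d (lin_map n d G ` X) F' \<le> (1 + 66 * e) * fl_opt d (lin_map n d G ` X) \<and>
    inverse e * fl_opt n X \<le> fl_cost n X (pull_back (lin_map n d G) X F')"
proof -
  define L where "L = real n / e"
  have L: "0 < L" using n e by (simp add: L_def)
  let ?g = "lin_map n d G"
  let ?x = "walk L"
  have X: "X = ?x ` {..<n}" by (simp add: X L_def)
  have finX: "finite X" by (simp add: X)
  have injx: "inj_on ?x A" for A using inj_walk[of L] L by (auto intro: inj_on_subset)
  have cardX: "card X = n" using injx by (simp add: X card_image)
  have cardgX: "card (?g ` X) = n" using inj cardX by (simp add: card_image)
  have jX: "?x j \<in> X" "?x (Suc j) \<in> X" and ne: "?x j \<noteq> ?x (Suc j)"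
    using short(1) injx[of UNIV] by (auto simp: X inj_eq)
  have gne: "?g (?x j) \<noteq> ?g (?x (Suc j))" using inj jX ne by (auto dest: inj_onD)
  let ?F = "?g ` X - {?g (?x j)}"
  have "fl_solution (?g ` X) ?F"
    unfolding fl_solution_def using jX gne by (metis Diff_subset empty_iff imageI insert_Diff insert_iff)

  have "edist d (?g (?x (Suc j))) (?g (?x j)) = L2_set (\<lambda>i. \<bar>L * G (i, j)\<bar>) {..<d}"
    unfolding edist_def L2_set_def
    using short(1) by (intro arg_cong[where f = sqrt] sum.cong) (auto simp: lin_map_walk_diff)
  \<comment> \<open>A vector of \<open>d\<close> entries \<open>s / sqrt d\<close> has norm
    \<open>s\<close>, so the dimension cancels against the standard deviation of the
    entries.\<close>
  also have "\<dots> \<le> L2_set (\<lambda>i. L * (32 * e\<^sup>2 * sqrt (1 / real d))) {..<d}"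
    using short(2) L by (intro L2_set_mono) (auto simp: abs_mult intro!: mult_left_mono)
  also have "\<dots> = L * 32 * e\<^sup>2"
    using L d by (simp add: L2_set_constant real_sqrt_divide)
  also have "\<dots> = 32 * real n * e"
    using e by (simp add: L_def power2_eq_square)
  finally have "edist d (?g (?x j)) (?g (?x (Suc j))) \<le> 32 * real n * e"
    by (simp add: edist_commute)
  then have cost: "fl_cost d (?g ` X) ?F \<le> real n + 32 * real n * e"
    using fl_cost_remove_le[of "?g ` X" "?g (?x j)" "?g (?x (Suc j))" d] finX jX gne cardgX by simp

  let ?C = "close_pairs n d L G"
  \<comment> \<open>The indices occurring in some close pair. Each pair contributes at most two,
    which accounts for the factor 1/2 in \<open>few\<close>; all other indices have isolated
    images.\<close>
  define bad where "bad = fst ` ?C \<union> snd ` ?C"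
  have finC: "finite ?C"
    by (rule finite_subset[of _ "{..<n} \<times> {..<n}"]) (auto simp: close_pairs_def)
  have "bad \<subseteq> {..<n}" by (auto simp: bad_def close_pairs_def)
  have "card bad \<le> card ?C + card ?C"
    unfolding bad_def using card_Un_le card_image_le[OF finC] add_mono le_trans by metis
  then have "real (card bad) \<le> real n * e" using few by (simp add: L_def)
  moreover have "card ({..<n} - bad) = n - card bad" "card bad \<le> n"
    using \<open>bad \<subseteq> {..<n}\<close> card_mono[OF _ \<open>bad \<subseteq> {..<n}\<close>]
    by (simp_all add: card_Diff_subset finite_subset)
  ultimately have "real n * (1 - e) \<le> real (card ({..<n} - bad))"
    by (simp add: of_nat_diff algebra_simps)
  also have "\<dots> = real (card (?g ` ?x ` ({..<n} - bad)))"
    using inj injx by (subst card_image) (auto simp: X card_image intro: inj_on_subset)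
  also have "\<dots> \<le> fl_opt d (?g ` X)"
  proof (rule fl_opt_ge_isolated)
    fix z y assume "z \<in> ?g ` ?x ` ({..<n} - bad)" and "y \<in> ?g ` X" and "y \<noteq> z"
    then obtain k l where kl: "z = ?g (?x k)" "y = ?g (?x l)" "k < n" "k \<notin> bad" "l < n" "k \<noteq> l"
      by (auto simp: X)
    have "(k, l) \<notin> ?C" "(l, k) \<notin> ?C" using kl(4) by (force simp: bad_def)+
    then have "1 \<le> \<bar>?g (?x k) 0 - ?g (?x l) 0\<bar>"
      using kl by (cases "l < k") (auto simp: close_pairs_def abs_minus_commute)
    also have "\<dots> \<le> edist d z y" unfolding kl by (rule abs_le_edist) (use d in simp)
    finally show "1 \<le> edist d z y" .
  qed (use finX jX in \<open>auto simp: X\<close>)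
  finally have opt: "real n * (1 - e) \<le> fl_opt d (?g ` X)" .

  \<comment> \<open>The difference of the two sides is \<open>33 * e - 66 * e^2\<close>, nonnegative
    exactly because \<open>e \<le> 1 / 2\<close>; this explains the constant 66.\<close>
  have "1 + 32 * e \<le> (1 + 66 * e) * (1 - e)"
    using mult_left_mono[OF e(2), of e] e(1) by (simp add: algebra_simps)
  then have "real n * (1 + 32 * e) \<le> (1 + 66 * e) * (real n * (1 - e))"
    using mult_left_mono[of "1 + 32 * e" "(1 + 66 * e) * (1 - e)" "real n"] by (simp add: algebra_simps)
  also have "\<dots> \<le> (1 + 66 * e) * fl_opt d (?g ` X)"
    using opt e by (intro mult_left_mono) auto
  finally have approx: "fl_cost d (?g ` X) ?F \<le> (1 + 66 * e) * fl_opt d (?g ` X)"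
    using cost by (simp add: algebra_simps)

  \<comment> \<open>By injectivity, closing one image point closes exactly one point of
    \<open>X\<close>.\<close>
  have pb: "pull_back ?g X ?F = X - {?x j}"
    using inj jX by (auto simp: pull_back_def dest: inj_onD)
  \<comment> \<open>Opening everything costs \<open>n\<close>, whereas the omitted point alone pays
    at least \<open>L = n / e\<close>; hence the ratio \<open>inverse e\<close>.\<close>
  have "fl_opt n X \<le> real n"
    using fl_opt_le[of X X n] fl_cost_all[OF finX, of n] finX jX cardX by (auto simp: fl_solution_def)
  then have "inverse e * fl_opt n X \<le> inverse e * real n"
    using e by (intro mult_left_mono) auto
  also have "\<dots> = L" by (simp add: L_def divide_inverse mult.commute)
  also have "L \<le> fl_cost n X (X - {?x j})"
  proof (rule fl_cost_remove_ge[OF finX jX(1)])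
    have "?x (Suc j) \<in> X - {?x j}" using jX(2) ne by (simp add: eq_commute)
    then show "X - {?x j} \<noteq> {}" by (metis empty_iff)
    fix y assume "y \<in> X" "y \<noteq> ?x j"
    then obtain l where l: "l < n" "y = ?x l" "l \<noteq> j" by (auto simp: X)
    have "1 \<le> \<bar>real j - real l\<bar>" using l by linarith
    then have "L * 1 \<le> L * sqrt \<bar>real j - real l\<bar>" using L by (intro mult_left_mono) auto
    then show "L \<le> edist n (?x j) y" using l L short(1) by (simp add: edist_walk)
  qed
  finally have "inverse e * fl_opt n X \<le> fl_cost n X (pull_back ?g X ?F)"
    unfolding pb .
  with \<open>fl_solution (?g ` X) ?F\<close> approx show ?thesis by blast
qed

text \<open>A short step and a small number of close pairs each occur with probability at least 5/6,
  and injectivity holds almost surely.\<close>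

lemma prob_bad_solution:
  fixes e :: real
  assumes n: "2 \<le> n" and d: "1 \<le> d" and e: "0 < e" "e \<le> 1 / 8"
    and ed: "e ^ (2 * d) = 1 / real n" and dn: "576 * real d \<le> real n"
    and X: "X = walk (real n / e) ` {..<n}"
  shows "\<P>(G in random_projection n d.
    \<exists>F'. fl_solution (lin_map n d G ` X) F' \<and>
      fl_cost d (lin_map n d G ` X) F' \<le> (1 + 66 * e) * fl_opt d (lin_map n d G ` X) \<and>
      inverse e * fl_opt n X \<le> fl_cost n X (pull_back (lin_map n d G) X F')) \<ge> 2 / 3"
proof -
  let ?M = "random_projection n d"
  have n1: "1 \<le> n" using n by simp
  interpret prob_space ?M by (rule prob_space_random_projection[OF d])
  define L where "L = real n / e"
  have L: "0 < L" using n e by (simp add: L_def)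
  let ?T = "{G \<in> space ?M. \<exists>F'. fl_solution (lin_map n d G ` X) F' \<and>
      fl_cost d (lin_map n d G ` X) F' \<le> (1 + 66 * e) * fl_opt d (lin_map n d G ` X) \<and>
      inverse e * fl_opt n X \<le> fl_cost n X (pull_back (lin_map n d G) X F')}"
  \<comment> \<open>The walk has \<open>n\<close> points and thus \<open>n - 1\<close> steps, so
    only columns \<open>j < n - 1\<close> count. With \<open>t = 32 * e^2\<close> the success
    probability of a column is at least \<open>(t / 4) ^ d = 8 ^ d / n \<ge> 8 / n\<close>.\<close>
  define S where "S = {G \<in> space ?M. \<exists>j<n - 1. \<forall>i<d. \<bar>G (i, j)\<bar> \<le> 32 * e\<^sup>2 * sqrt (1 / real d)}"
  define B where "B = {G \<in> space ?M. real (card (close_pairs n d L G)) < real n * e / 2}"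

  have "e\<^sup>2 \<le> (1 / 8)\<^sup>2" using e by (intro power_mono) auto
  then have t: "0 \<le> 32 * e\<^sup>2" "32 * e\<^sup>2 \<le> 1" by (auto simp: power2_eq_square)
  have "8 / real n \<le> 8 ^ d / real n"
    using d self_le_power[of "8::real" d] by (intro divide_right_mono) auto
  also have "\<dots> = (32 * e\<^sup>2 / 4) ^ d"
    using ed by (simp add: power_mult_distrib power_mult)
  finally have "real (n - 1) * (8 / real n) \<le> real (n - 1) * (32 * e\<^sup>2 / 4) ^ d"
    by (intro mult_left_mono) auto
  \<comment> \<open>From \<open>n \<ge> 2\<close> follows \<open>n - 1 \<ge> n / 2\<close>.\<close>
  moreover have "4 \<le> real (n - 1) * (8 / real n)"
    using n by (simp add: of_nat_diff field_simps)
  ultimately have "4 \<le> real (n - 1) * (32 * e\<^sup>2 / 4) ^ d" by linarith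
  then have "exp (- real (n - 1) * (32 * e\<^sup>2 / 4) ^ d) \<le> exp (- 4)"
    by (simp only: exp_le_cancel_iff mult_minus_left neg_le_iff_le)
  also have "exp (- 4 :: real) \<le> 1 / 6"
  proof -
    have "6 \<le> (1 + 2 :: real) ^ 2" by simp
    also have "\<dots> \<le> exp 2 ^ 2" by (intro power_mono exp_ge_add_one_self) auto
    also have "\<dots> = exp (4 :: real)" by (simp add: exp_of_nat_mult[symmetric])
    finally show ?thesis by (simp add: exp_minus field_simps)
  qed
  finally have S: "5 / 6 \<le> prob S"
    using prob_ex_small_column[OF n1 d t, of "n - 1"] by (simp add: S_def)

  \<comment> \<open>For the threshold \<open>c = n * e / 2\<close> the product \<open>L * c\<close>
    is \<open>n^2 / 2\<close>, free of \<open>e\<close>. Since 576 = 24^2, the assumption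
    \<open>dn\<close> makes the failure probability at most 4/24.\<close>
  have "2 * real n * sqrt (real n * real d) / (L * (real n * e / 2)) = 4 * sqrt (real n * real d) / real n"
    using n e by (simp add: L_def field_simps)
  also have "\<dots> \<le> 1 / 6"
  proof -
    have "real n * real d \<le> (real n / 24)\<^sup>2"
      using mult_left_mono[OF dn, of "real n"] by (simp add: power2_eq_square)
    then have "sqrt (real n * real d) \<le> real n / 24" by (intro real_le_lsqrt) auto
    then show ?thesis using n by (simp add: field_simps)
  qed
  finally have B: "5 / 6 \<le> prob B"
    using close_pairs_Markov[OF n1 d L, of "real n * e / 2"] n e by (simp add: B_def)

  \<comment> \<open>Non-measurable sets have measure 0.\<close>
  have sets: "S \<in> events" "B \<in> events"
    using S B measure_notin_sets[of S ?M] measure_notin_sets[of B ?M] by fastforce+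
  have T: "?T \<in> events"
    using pred_ex_fl_solution[of X d "lin_map n d" ?M, OF _ measurable_edist_lin_map[OF n1 d] pred_lin_map_eq[OF n1 d]]
    by (simp add: X pred_def)
  \<comment> \<open>Injectivity may fail on a null set, so the inclusion holds only almost
    everywhere.\<close>
  have "AE G in ?M. G \<in> S \<inter> B \<longrightarrow> G \<in> ?T"
    using AE_inj_on_lin_map_walk[OF n1 d L]
  proof eventually_elim
    case (elim G)
    show ?case
    proof
      assume G: "G \<in> S \<inter> B"
      then obtain j where "j < n - 1" "\<forall>i<d. \<bar>G (i, j)\<bar> \<le> 32 * e\<^sup>2 * sqrt (1 / real d)"
        by (auto simp: S_def)
      with ex_bad_solution[OF n d e(1) _ X, of G j] G elim e show "G \<in> ?T"
        by (auto simp: B_def L_def X)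
    qed
  qed
  then have "prob (S \<inter> B) \<le> prob ?T" using T by (rule finite_measure_mono_AE)
  \<comment> \<open>Inclusion-exclusion gives 5/6 + 5/6 - 1 = 2/3 without independence of
    \<open>S\<close> and \<open>B\<close>.\<close>
  moreover have "prob (S \<union> B) = prob S + prob B - prob (S \<inter> B)"
    using sets by (intro measure_Un3) (auto simp: fmeasurable_eq_sets)
  moreover have "prob (S \<union> B) \<le> 1" by simp
  ultimately show ?thesis using S B by linarith
qed

section \<open>Asymptotics in \<open>n\<close>\<close>

lemma filterlim_powr_inverse_smallo_ln:
  fixes d :: "nat \<Rightarrow> nat"
  assumes d: "\<And>n. 1 \<le> d n" and o: "(\<lambda>n. real (d n)) \<in> o(\<lambda>n. ln (real n))"
  shows "filterlim (\<lambda>n. real n powr (1 / (2 * real (d n)))) at_top sequentially"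
  unfolding filterlim_at_top_gt[where c = 0]
proof (intro allI impI)
  fix Z :: real assume Z: "0 < Z"
  \<comment> \<open>The power equals \<open>exp (ln n / (2 * d n))\<close>, which exceeds its
    exponent; the factor \<open>1 / (2 * Z)\<close> makes that exponent at least
    \<open>Z\<close>.\<close>
  have "\<forall>\<^sub>F n in sequentially. norm (real (d n)) \<le> 1 / (2 * Z) * norm (ln (real n))"
    using landau_o.smallD[OF o, of "1 / (2 * Z)"] Z by simp
  then show "\<forall>\<^sub>F n in sequentially. Z \<le> real n powr (1 / (2 * real (d n)))"
    using eventually_ge_at_top[of 2]
  proof eventually_elim
    case (elim n)
    then have "Z \<le> ln (real n) / (2 * real (d n))"
      using Z d[of n] by (simp add: field_simps)
    also have "\<dots> \<le> exp (ln (real n) / (2 * real (d n)))"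
      using exp_ge_add_one_self[of "ln (real n) / (2 * real (d n))"] by linarith
    finally show ?case using elim by (simp add: powr_def)
  qed
qed

theorem lemma6p4:
  fixes d :: "nat \<Rightarrow> nat"
  assumes "\<And>n. 1 \<le> d n"
    and "(\<lambda>n. real (d n)) \<in> o(\<lambda>n. ln (real n))"
  shows "\<exists>A>0. \<exists>a>0. \<exists>D>0.
    (\<lambda>n. A * real n powr (- (1 / (2 * real (d n))))) \<in> o(\<lambda>_. 1) \<and>
    (\<lambda>n. a * real n powr (1 / (2 * real (d n)))) \<in> \<omega>(\<lambda>_. 1) \<and>
    (\<forall>\<^sub>F n in sequentially.
      \<exists>X. X \<subseteq> topspace (Euclidean_space n) \<and> finite X \<and> card X = n \<and> doubling_dim n X \<le> D \<and>
        \<P>(G in random_projection n (d n).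
            \<exists>F'. fl_solution (lin_map n (d n) G ` X) F' \<and>
              fl_cost (d n) (lin_map n (d n) G ` X) F'
                \<le> (1 + A * real n powr (- (1 / (2 * real (d n)))))
                    * fl_opt (d n) (lin_map n (d n) G ` X) \<and>
              fl_cost n X (pull_back (lin_map n (d n) G) X F')
                \<ge> a * real n powr (1 / (2 * real (d n))) * fl_opt n X) \<ge> 2 / 3)"
proof -
  define e where "e n = real n powr (- (1 / (2 * real (d n))))" for n
  have inv_e: "real n powr (1 / (2 * real (d n))) = inverse (e n)" for n
    by (simp add: e_def powr_minus)
  note lim = filterlim_powr_inverse_smallo_ln[OF assms]
  have e_lim: "e \<longlonglongrightarrow> 0"
    using tendsto_inverse_0_at_top[OF lim] by (simp add: e_def[abs_def] powr_minus)
  show ?thesis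
  \<comment> \<open>\<open>A = 66\<close> and \<open>a = 1\<close> come from
    \<open>prob_bad_solution\<close>, where the lower bound is exactly
    \<open>inverse e * fl_opt n X\<close>; \<open>D = 4\<close> comes from
    \<open>doubling_dim_walk\<close>.\<close>
  proof (rule exI[of _ 66], intro conjI, simp, rule exI[of _ 1], intro conjI, simp, rule exI[of _ 4], intro conjI)
    show "(\<lambda>n. 66 * real n powr (- (1 / (2 * real (d n))))) \<in> o(\<lambda>_. 1)"
      using tendsto_mult_left[OF e_lim, of 66] by (intro smalloI_tendsto) (simp_all add: e_def)
    show "(\<lambda>n. 1 * real n powr (1 / (2 * real (d n)))) \<in> \<omega>(\<lambda>_. 1)"
      using lim by (intro smallomegaI_filterlim_at_top_norm) simp_all
    \<comment> \<open>The factor 1/576 yields \<open>576 * d n \<le> ln n \<le> n - 1\<close>, which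
      covers the condition \<open>dn\<close> of \<open>prob_bad_solution\<close>.\<close>
    have "\<forall>\<^sub>F n in sequentially. norm (real (d n)) \<le> 1 / 576 * norm (ln (real n))"
      by (rule landau_o.smallD[OF assms(2)]) simp
    moreover have "\<forall>\<^sub>F n in sequentially. e n < 1 / 8"
      using e_lim by (rule order_tendstoD) simp
    ultimately show "\<forall>\<^sub>F n in sequentially.
      \<exists>X. X \<subseteq> topspace (Euclidean_space n) \<and> finite X \<and> card X = n \<and> doubling_dim n X \<le> 4 \<and>
        \<P>(G in random_projection n (d n).
            \<exists>F'. fl_solution (lin_map n (d n) G ` X) F' \<and>
              fl_cost (d n) (lin_map n (d n) G ` X) F'
                \<le> (1 + 66 * real n powr (- (1 / (2 * real (d n)))))
                    * fl_opt (d n) (lin_map n (d n) G ` X) \<and>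
              fl_cost n X (pull_back (lin_map n (d n) G) X F')
                \<ge> 1 * real n powr (1 / (2 * real (d n))) * fl_opt n X) \<ge> 2 / 3"
      using eventually_ge_at_top[of 2]
    proof eventually_elim
      case (elim n)
      have e: "0 < e n" using elim by (simp add: e_def)
      have "e n ^ (2 * d n) = real n powr (- (1 / (2 * real (d n))) * real (2 * d n))"
        using elim by (simp add: e_def powr_realpow[symmetric] powr_powr)
      also have "\<dots> = 1 / real n"
        using elim assms(1)[of n] by (simp add: powr_minus_divide)
      finally have ed: "e n ^ (2 * d n) = 1 / real n" .
      have dn: "576 * real (d n) \<le> real n"
        using elim ln_le_minus_one[of "real n"] by simp
      let ?X = "walk (real n / e n) ` {..<n}"
      have "0 < real n / e n" using e elim by simp
      show ?case
      proof (intro exI[of _ ?X] conjI)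
        show "?X \<subseteq> topspace (Euclidean_space n)"
          by (auto intro: walk_in_Euclidean_space)
        show "card ?X = n"
          using inj_on_subset[OF inj_walk[of "real n / e n"]] e elim(3)
          by (subst card_image) auto
        show "doubling_dim n ?X \<le> 4"
          using \<open>0 < real n / e n\<close> by (rule doubling_dim_walk)
        show "\<P>(G in random_projection n (d n).
            \<exists>F'. fl_solution (lin_map n (d n) G ` ?X) F' \<and>
              fl_cost (d n) (lin_map n (d n) G ` ?X) F'
                \<le> (1 + 66 * real n powr (- (1 / (2 * real (d n)))))
                    * fl_opt (d n) (lin_map n (d n) G ` ?X) \<and>
              fl_cost n ?X (pull_back (lin_map n (d n) G) ?X F')
                \<ge> 1 * real n powr (1 / (2 * real (d n))) * fl_opt n ?X) \<ge> 2 / 3"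
          using prob_bad_solution[OF elim(3) assms(1) e _ ed dn refl] elim(2)
          unfolding inv_e mult_1 e_def[symmetric] by simp
      qed simp
    qed
  qed simp_all
qed

end
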